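(* Let $\lambda$ be a partition, let $T$ be a reverse plane partition of shape $\lambda$, and let $T_{\min}=T_{\min}(\lambda)$ be the SSYT of shape $\lambda$ with all entries of row $i$ equal to $i-1$. Then $HG(T)+HG(T_{\min})=HG(T+T_{\min})$, where sums of arrays and of plane partitions are entrywise.
   Context: $[\lambda]=\{(i,j):1\le i\le\ell(\lambda),1\le j\le\lambda_i\}$ (English convention: rows downward, columns rightward). A reverse plane partition of shape $\lambda$ is a filling of $[\lambda]$ by nonnegative integers weakly increasing along rows and columns. Hillman–Grassl map $HG$: for such $\pi$, start with the zero array $A$ of shape $\lambda$. While $\pi\neq0$: let $b$ be the leftmost column containing a nonzero entry and $a$ the lowest row with $\pi(a,b)\ne0$; build a path from $(a,b)$: at $(x,y)$, if $(x-1,y)\in[\lambda]$ and $\pi(x-1,y)=\pi(x,y)$ move to $(x-1,y)$, otherwise if $(x,y+1)\in[\lambda]$ move to $(x,y+1)$, otherwise stop; if the path ends in row $r$, subtract $1$ from each entry of $\pi$ on the path and add $1$ to $A(r,b)$. $HG(\pi)$ is the final array. *)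

theory Defs
  imports Complex_Main "HOL-Library.While_Combinator"
begin

text \<open>Partitions are weakly decreasing lists of positive parts; rows and columns are numbered
  from 1, so row \<open>i\<close> has length \<open>lam ! (i - 1)\<close>.\<close>

definition is_partition :: "nat list \<Rightarrow> bool" where
  "is_partition lam \<longleftrightarrow> sorted_wrt (\<ge>) lam \<and> (\<forall>p \<in> set lam. p \<ge> 1)"

definition diagram :: "nat list \<Rightarrow> (nat \<times> nat) set" where
  "diagram lam = {(i, j). 1 \<le> i \<and> i \<le> length lam \<and> 1 \<le> j \<and> j \<le> lam ! (i - 1)}"

text \<open>A filling of the diagram is represented by the function that extends it by zero, so that
  equality of fillings is equality of functions.\<close>

definition is_filling :: "nat list \<Rightarrow> (nat \<times> nat \<Rightarrow> nat) \<Rightarrow> bool" where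
  "is_filling lam \<pi> \<longleftrightarrow> (\<forall>c. c \<notin> diagram lam \<longrightarrow> \<pi> c = 0)"

definition weakly_increasing_rows :: "nat list \<Rightarrow> (nat \<times> nat \<Rightarrow> nat) \<Rightarrow> bool" where
  "weakly_increasing_rows lam \<pi> \<longleftrightarrow>
     (\<forall>i j j'. (i, j) \<in> diagram lam \<and> (i, j') \<in> diagram lam \<and> j \<le> j' \<longrightarrow> \<pi> (i, j) \<le> \<pi> (i, j'))"

definition weakly_increasing_columns :: "nat list \<Rightarrow> (nat \<times> nat \<Rightarrow> nat) \<Rightarrow> bool" where
  "weakly_increasing_columns lam \<pi> \<longleftrightarrow>
     (\<forall>i i' j. (i, j) \<in> diagram lam \<and> (i', j) \<in> diagram lam \<and> i \<le> i' \<longrightarrow> \<pi> (i, j) \<le> \<pi> (i', j))"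

definition strictly_increasing_columns :: "nat list \<Rightarrow> (nat \<times> nat \<Rightarrow> nat) \<Rightarrow> bool" where
  "strictly_increasing_columns lam \<pi> \<longleftrightarrow>
     (\<forall>i i' j. (i, j) \<in> diagram lam \<and> (i', j) \<in> diagram lam \<and> i < i' \<longrightarrow> \<pi> (i, j) < \<pi> (i', j))"

definition is_rpp :: "nat list \<Rightarrow> (nat \<times> nat \<Rightarrow> nat) \<Rightarrow> bool" where
  "is_rpp lam \<pi> \<longleftrightarrow>
     is_filling lam \<pi> \<and> weakly_increasing_rows lam \<pi> \<and> weakly_increasing_columns lam \<pi>"

definition is_ssyt :: "nat list \<Rightarrow> (nat \<times> nat \<Rightarrow> nat) \<Rightarrow> bool" where
  "is_ssyt lam \<pi> \<longleftrightarrow>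
     is_filling lam \<pi> \<and> weakly_increasing_rows lam \<pi> \<and> strictly_increasing_columns lam \<pi>"

definition T_min :: "nat list \<Rightarrow> nat \<times> nat \<Rightarrow> nat" where
  "T_min lam = (\<lambda>(i, j). if (i, j) \<in> diagram lam then i - 1 else 0)"

lemma is_ssyt_T_min: "is_ssyt lam (T_min lam)"
  by (auto simp: is_ssyt_def is_filling_def weakly_increasing_rows_def
      strictly_increasing_columns_def T_min_def diagram_def)

text \<open>The path starting from \<open>(x, y)\<close>. In row 1 the cell \<open>(x - 1, y)\<close> has row index 0 and hence
  lies outside the diagram, as it should.\<close>

function hg_path :: "nat list \<Rightarrow> (nat \<times> nat \<Rightarrow> nat) \<Rightarrow> nat \<Rightarrow> nat \<Rightarrow> (nat \<times> nat) list" where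
  "hg_path lam \<pi> x y =
     (if (x - 1, y) \<in> diagram lam \<and> \<pi> (x - 1, y) = \<pi> (x, y) then (x, y) # hg_path lam \<pi> (x - 1) y
      else if (x, y + 1) \<in> diagram lam then (x, y) # hg_path lam \<pi> x (y + 1)
      else [(x, y)])"
  by pat_completeness auto
termination
proof (relation "measure (\<lambda>(lam, \<pi>, x, y). x + (sum_list lam - y))", goal_cases)
  case 1
  show ?case by simp
next
  case (2 lam \<pi> x y)
  then show ?case by (auto simp: diagram_def)
next
  case (3 lam \<pi> x y)
  then have x: "x - 1 < length lam" and y: "y + 1 \<le> lam ! (x - 1)"
    by (auto simp: diagram_def)
  have "lam ! (x - 1) \<le> sum_list lam"
    using x by (simp add: member_le_sum_list)
  with y show ?case by simp
qed

declare hg_path.simps [simp del]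

definition hg_start_col :: "nat list \<Rightarrow> (nat \<times> nat \<Rightarrow> nat) \<Rightarrow> nat" where
  "hg_start_col lam \<pi> = (LEAST b. \<exists>a. (a, b) \<in> diagram lam \<and> \<pi> (a, b) \<noteq> 0)"

definition hg_start_row :: "nat list \<Rightarrow> (nat \<times> nat \<Rightarrow> nat) \<Rightarrow> nat" where
  "hg_start_row lam \<pi> =
     (GREATEST a. (a, hg_start_col lam \<pi>) \<in> diagram lam \<and> \<pi> (a, hg_start_col lam \<pi>) \<noteq> 0)"

definition hg_step ::
  "nat list \<Rightarrow> (nat \<times> nat \<Rightarrow> nat) \<times> (nat \<times> nat \<Rightarrow> nat) \<Rightarrow> (nat \<times> nat \<Rightarrow> nat) \<times> (nat \<times> nat \<Rightarrow> nat)" where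
  "hg_step lam = (\<lambda>(\<pi>, A).
     let b = hg_start_col lam \<pi>;
         a = hg_start_row lam \<pi>;
         P = hg_path lam \<pi> a b;
         r = fst (last P)
     in (\<lambda>c. if c \<in> set P then \<pi> c - 1 else \<pi> c, A((r, b) := A (r, b) + 1)))"

definition HG :: "nat list \<Rightarrow> (nat \<times> nat \<Rightarrow> nat) \<Rightarrow> nat \<times> nat \<Rightarrow> nat" where
  "HG lam \<pi> =
     snd (while (\<lambda>(\<pi>, A). \<exists>c \<in> diagram lam. \<pi> c \<noteq> 0) (hg_step lam) (\<pi>, \<lambda>_. 0))"

text \<open>The loop always terminates, because each step decreases the sum of the entries.\<close>

lemma finite_diagram: "finite (diagram lam)"
proof (rule finite_subset)
  show "diagram lam \<subseteq> {..length lam} \<times> {..sum_list lam}"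
  proof clarsimp
    fix i j assume "(i, j) \<in> diagram lam"
    then have "i \<le> length lam" "i - 1 < length lam" "j \<le> lam ! (i - 1)"
      by (auto simp: diagram_def)
    moreover have "lam ! (i - 1) \<le> sum_list lam"
      using \<open>i - 1 < length lam\<close> by (simp add: member_le_sum_list)
    ultimately show "i \<le> length lam \<and> j \<le> sum_list lam" by simp
  qed
qed simp

lemma hg_start_cell:
  assumes "\<exists>c \<in> diagram lam. \<pi> c \<noteq> 0"
  shows "(hg_start_row lam \<pi>, hg_start_col lam \<pi>) \<in> diagram lam"
    and "\<pi> (hg_start_row lam \<pi>, hg_start_col lam \<pi>) \<noteq> 0"
proof -
  let ?b = "hg_start_col lam \<pi>"
  have "\<exists>b a. (a, b) \<in> diagram lam \<and> \<pi> (a, b) \<noteq> 0"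
    using assms by auto
  then have ex: "\<exists>a. (a, ?b) \<in> diagram lam \<and> \<pi> (a, ?b) \<noteq> 0"
    unfolding hg_start_col_def by (rule LeastI_ex)
  have bound: "\<And>a. (a, ?b) \<in> diagram lam \<and> \<pi> (a, ?b) \<noteq> 0 \<Longrightarrow> a \<le> length lam"
    by (auto simp: diagram_def)
  have "(hg_start_row lam \<pi>, ?b) \<in> diagram lam \<and> \<pi> (hg_start_row lam \<pi>, ?b) \<noteq> 0"
    unfolding hg_start_row_def using GreatestI_ex_nat[OF ex bound] by blast
  then show "(hg_start_row lam \<pi>, ?b) \<in> diagram lam" "\<pi> (hg_start_row lam \<pi>, ?b) \<noteq> 0"
    by auto
qed

lemma hg_path_start: "(x, y) \<in> set (hg_path lam \<pi> x y)"
  by (subst hg_path.simps) auto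

lemma HG_terminates:
  "\<exists>s. while_option (\<lambda>(\<pi>, A). \<exists>c \<in> diagram lam. \<pi> c \<noteq> 0) (hg_step lam) (\<pi>, \<lambda>_. 0) = Some s"
proof (rule measure_while_option_Some[where P = "\<lambda>_. True" and f = "\<lambda>(\<pi>, A). sum \<pi> (diagram lam)"])
  fix s :: "(nat \<times> nat \<Rightarrow> nat) \<times> (nat \<times> nat \<Rightarrow> nat)"
  assume b: "case s of (\<pi>, A) \<Rightarrow> \<exists>c \<in> diagram lam. \<pi> c \<noteq> 0"
  obtain \<rho> A where s: "s = (\<rho>, A)" by force
  let ?c = "(hg_start_row lam \<rho>, hg_start_col lam \<rho>)"
  let ?P = "hg_path lam \<rho> (hg_start_row lam \<rho>) (hg_start_col lam \<rho>)"
  have c: "?c \<in> diagram lam" "\<rho> ?c \<noteq> 0"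
    using hg_start_cell b s by auto
  have "(\<Sum>c\<in>diagram lam. if c \<in> set ?P then \<rho> c - 1 else \<rho> c) < sum \<rho> (diagram lam)"
  proof (rule sum_strict_mono_ex1[OF finite_diagram])
    show "\<exists>c\<in>diagram lam. (if c \<in> set ?P then \<rho> c - 1 else \<rho> c) < \<rho> c"
      using c by (intro bexI[of _ ?c]) (auto simp: hg_path_start)
  qed auto
  then show "True \<and> (case hg_step lam s of (\<pi>, A) \<Rightarrow> sum \<pi> (diagram lam))
      < (case s of (\<pi>, A) \<Rightarrow> sum \<pi> (diagram lam))"
    by (simp add: s hg_step_def Let_def)
qed simp

end

theory Submission
  imports Defs
begin

text \<open>Let \<open>\<pi>'\<close> be what the algorithm leaves of \<open>\<pi>\<close> after removing all paths that start in its first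
  nonzero column. It is given by a piecewise-linear (toggle) recurrence in terms of \<open>\<pi>\<close>, and the
  number of removed paths ending in a given row is a piecewise-linear function of \<open>\<pi>\<close> and \<open>\<pi>'\<close>.
  For a fixed \<open>\<pi>'\<close>, the removal of a single path preserves the recurrence, because no later path
  passes below an earlier one. Now add to every row \<open>x\<close> of \<open>\<pi>\<close> a constant \<open>S x\<close>, where \<open>S\<close> is
  weakly increasing and \<open>S 0 = 0\<close>: the recurrence shows that row \<open>x\<close> of \<open>\<pi>'\<close> grows by \<open>S (x - 1)\<close>,
  and that \<open>S x - S (x - 1)\<close> more paths end in row \<open>x\<close>. Iterating over the columns, the output of the
  algorithm changes by an array that depends only on \<open>S\<close> and the shape, and the zero filling
  identifies it as the image of the filling \<open>S\<close> itself.\<close>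

section \<open>Diagrams and reverse plane partitions\<close>

lemma diagram_pos: "(x, y) \<in> diagram lam \<Longrightarrow> 1 \<le> x \<and> 1 \<le> y"
  by (simp add: diagram_def)

lemma diagram_down_closed:
  assumes "is_partition lam" "(x, y) \<in> diagram lam" "1 \<le> x'" "x' \<le> x" "1 \<le> y'" "y' \<le> y"
  shows "(x', y') \<in> diagram lam"
proof -
  have x: "1 \<le> x" "x \<le> length lam" and y: "y \<le> lam ! (x - 1)"
    using assms(2) by (auto simp: diagram_def)
  have "lam ! (x - 1) \<le> lam ! (x' - 1)"
  proof (cases "x' = x")
    case False
    then have "x' - 1 < x - 1" "x - 1 < length lam"
      using assms x by auto
    then show ?thesis
      using assms(1) unfolding is_partition_def sorted_wrt_iff_nth_less by blast
  qed simp
  then show ?thesis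
    using assms x y by (auto simp: diagram_def)
qed

lemma is_rpp_row:
  "is_rpp lam \<pi> \<Longrightarrow> (x, y) \<in> diagram lam \<Longrightarrow> (x, y') \<in> diagram lam \<Longrightarrow> y \<le> y' \<Longrightarrow> \<pi> (x, y) \<le> \<pi> (x, y')"
  unfolding is_rpp_def weakly_increasing_rows_def by blast

lemma is_rpp_column:
  "is_rpp lam \<pi> \<Longrightarrow> (x, y) \<in> diagram lam \<Longrightarrow> (x', y) \<in> diagram lam \<Longrightarrow> x \<le> x' \<Longrightarrow> \<pi> (x, y) \<le> \<pi> (x', y)"
  unfolding is_rpp_def weakly_increasing_columns_def by blast

lemma is_rpp_outside: "is_rpp lam \<pi> \<Longrightarrow> c \<notin> diagram lam \<Longrightarrow> \<pi> c = 0"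
  unfolding is_rpp_def is_filling_def by blast

lemma is_rpp_left:
  assumes "is_rpp lam \<pi>" "(x, y) \<in> diagram lam"
  shows "\<pi> (x, y - 1) \<le> \<pi> (x, y)"
proof (cases "(x, y - 1) \<in> diagram lam")
  case True
  then show ?thesis using is_rpp_row assms by (metis diff_le_self)
qed (use is_rpp_outside[OF assms(1)] in simp)

lemma is_rpp_above:
  assumes "is_rpp lam \<pi>" "(x, y) \<in> diagram lam"
  shows "\<pi> (x - 1, y) \<le> \<pi> (x, y)"
proof (cases "(x - 1, y) \<in> diagram lam")
  case True
  then show ?thesis using is_rpp_column assms by (metis diff_le_self)
qed (use is_rpp_outside[OF assms(1)] in simp)

lemma is_rppI_adjacent:
  assumes part: "is_partition lam" and fill: "is_filling lam \<pi>"
    and row: "\<And>x y. (x, y) \<in> diagram lam \<Longrightarrow> (x, y + 1) \<in> diagram lam \<Longrightarrow> \<pi> (x, y) \<le> \<pi> (x, y + 1)"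
    and col: "\<And>x y. (x, y) \<in> diagram lam \<Longrightarrow> (x + 1, y) \<in> diagram lam \<Longrightarrow> \<pi> (x, y) \<le> \<pi> (x + 1, y)"
  shows "is_rpp lam \<pi>"
proof -
  have rows: "\<pi> (x, y) \<le> \<pi> (x, y')" if "y \<le> y'" "(x, y) \<in> diagram lam" "(x, y') \<in> diagram lam" for x y y'
    using that
  proof (induction y' rule: dec_induct)
    case (step n)
    then have "(x, n) \<in> diagram lam"
      using diagram_down_closed[OF part, of x "Suc n" x n] diagram_pos[of x y lam] by auto
    then show ?case using step row[of x n] by fastforce
  qed simp
  have cols: "\<pi> (x, y) \<le> \<pi> (x', y)" if "x \<le> x'" "(x, y) \<in> diagram lam" "(x', y) \<in> diagram lam" for x x' y
    using that
  proof (induction x' rule: dec_induct)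
    case (step n)
    then have "(n, y) \<in> diagram lam"
      using diagram_down_closed[OF part, of "Suc n" y n y] diagram_pos[of x y lam] by auto
    then show ?case using step col[of n y] by fastforce
  qed simp
  show ?thesis
    using fill rows cols
    unfolding is_rpp_def weakly_increasing_rows_def weakly_increasing_columns_def by blast
qed

section \<open>Hillman--Grassl paths\<close>

definition hg_up :: "nat list \<Rightarrow> (nat \<times> nat \<Rightarrow> nat) \<Rightarrow> nat \<Rightarrow> nat \<Rightarrow> bool" where
  "hg_up lam \<pi> x y \<longleftrightarrow> (x - 1, y) \<in> diagram lam \<and> \<pi> (x - 1, y) = \<pi> (x, y)"

lemma hg_path_cases:
  obtains (up) "hg_up lam \<pi> x y" "hg_path lam \<pi> x y = (x, y) # hg_path lam \<pi> (x - 1) y"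
  | (right) "\<not> hg_up lam \<pi> x y" "(x, y + 1) \<in> diagram lam"
      "hg_path lam \<pi> x y = (x, y) # hg_path lam \<pi> x (y + 1)"
  | (stop) "\<not> hg_up lam \<pi> x y" "(x, y + 1) \<notin> diagram lam" "hg_path lam \<pi> x y = [(x, y)]"
  using hg_path.simps[of lam \<pi> x y] unfolding hg_up_def by meson

text \<open>Keeps \<open>lam\<close> and \<open>\<pi>\<close> fixed, unlike the induction rule of
  the function, and hands each case the unfolded path.\<close>

lemma hg_path_induct [case_names up right stop]:
  assumes "\<And>x y. hg_up lam \<pi> x y \<Longrightarrow> hg_path lam \<pi> x y = (x, y) # hg_path lam \<pi> (x - 1) y \<Longrightarrow>
      Q (x - 1) y \<Longrightarrow> Q x y"
    and "\<And>x y. \<not> hg_up lam \<pi> x y \<Longrightarrow> (x, y + 1) \<in> diagram lam \<Longrightarrow>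
      hg_path lam \<pi> x y = (x, y) # hg_path lam \<pi> x (y + 1) \<Longrightarrow> Q x (y + 1) \<Longrightarrow> Q x y"
    and "\<And>x y. \<not> hg_up lam \<pi> x y \<Longrightarrow> (x, y + 1) \<notin> diagram lam \<Longrightarrow>
      hg_path lam \<pi> x y = [(x, y)] \<Longrightarrow> Q x y"
  shows "Q x y"
proof -
  have "Q x y" if "l = lam" "p = \<pi>" for l p
    using that
  proof (induction l p x y rule: hg_path.induct)
    case (1 l p x y)
    show ?case
      using assms 1 by (cases lam \<pi> x y rule: hg_path_cases) (auto simp: hg_up_def)
  qed
  then show ?thesis by blast
qed

lemma hg_path_bound: "(u, v) \<in> set (hg_path lam \<pi> x y) \<Longrightarrow> u \<le> x \<and> y \<le> v"
  by (induction x y rule: hg_path_induct[of lam \<pi>]) auto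

lemma hg_path_subset_diagram:
  "(x, y) \<in> diagram lam \<Longrightarrow> set (hg_path lam \<pi> x y) \<subseteq> diagram lam"
  by (induction x y rule: hg_path_induct[of lam \<pi>]) (auto simp: hg_up_def)

text \<open>The path moves only up and right, so it never comes back down. This excludes path cells
  below and to the right of a given one.\<close>

lemma hg_path_chain:
  assumes "(u, v) \<in> set (hg_path lam \<pi> x y)" "(u', v') \<in> set (hg_path lam \<pi> x y)" "v < v'"
  shows "u' \<le> u"
  using assms
  by (induction x y rule: hg_path_induct[of lam \<pi>]) (auto dest: hg_path_bound)

lemma hg_path_up:
  "(u, v) \<in> set (hg_path lam \<pi> x y) \<Longrightarrow> hg_up lam \<pi> u v \<Longrightarrow> (u - 1, v) \<in> set (hg_path lam \<pi> x y)"
  by (induction x y rule: hg_path_induct[of lam \<pi>]) (auto simp: hg_path_start)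

lemma hg_path_right:
  "(u, v) \<in> set (hg_path lam \<pi> x y) \<Longrightarrow> \<not> hg_up lam \<pi> u v \<Longrightarrow> (u, v + 1) \<in> diagram lam \<Longrightarrow>
    (u, v + 1) \<in> set (hg_path lam \<pi> x y)"
  using hg_path_start by (induction x y rule: hg_path_induct[of lam \<pi>]) auto

lemma hg_path_pred:
  assumes "(u, v) \<in> set (hg_path lam \<pi> x y)"
  shows "(u, v) = (x, y) \<or> (u + 1, v) \<in> set (hg_path lam \<pi> x y) \<and> hg_up lam \<pi> (u + 1) v \<or>
    1 \<le> v \<and> (u, v - 1) \<in> set (hg_path lam \<pi> x y) \<and> \<not> hg_up lam \<pi> u (v - 1)"
  using assms
proof (induction x y rule: hg_path_induct[of lam \<pi>])
  case (up x y)
  \<comment> \<open>This undoes the truncated subtraction, \<open>x - 1 + 1 = x\<close>: the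
    predecessor of \<open>(x - 1, y)\<close> is the cell one row below it.\<close>
  then have "1 \<le> x - 1" by (auto simp: hg_up_def diagram_def)
  then show ?case using up by (auto simp: hg_path_start)
qed auto

text \<open>Every earlier cell has a successor, so being unable to move singles out the last cell.
  The exit row thus becomes a condition on single cells.\<close>

lemma hg_path_last_iff:
  "(u, v) = last (hg_path lam \<pi> x y) \<longleftrightarrow>
    (u, v) \<in> set (hg_path lam \<pi> x y) \<and> \<not> hg_up lam \<pi> u v \<and> (u, v + 1) \<notin> diagram lam"
proof (induction x y rule: hg_path_induct[of lam \<pi>])
  case (up x y)
  then show ?case using hg_path_start[of "x - 1" y lam \<pi>] by (auto split: if_splits)
next
  case (right x y)
  then show ?case using hg_path_start[of x "y + 1" lam \<pi>] by (auto split: if_splits)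
qed auto

section \<open>Clearing one column\<close>

text \<open>If \<open>\<pi>\<close> vanishes left of column \<open>b\<close>, then \<open>\<pi>'\<close> is what remains of \<open>\<pi>\<close> once all paths starting
  in column \<open>b\<close> have been removed. The recurrence is the piecewise-linear toggle, written without
  subtraction. It comes from counting paths: \<open>\<pi> (x, y - 1) - max (\<pi>' (x, y - 1)) (\<pi> (x - 1, y - 1))\<close>
  of them enter \<open>(x, y)\<close> from the left and \<open>\<pi> (x, y) - min (\<pi> (x, y)) (\<pi>' (x + 1, y))\<close> from below.\<close>

definition column_residue ::
  "nat list \<Rightarrow> nat \<Rightarrow> (nat \<times> nat \<Rightarrow> nat) \<Rightarrow> (nat \<times> nat \<Rightarrow> nat) \<Rightarrow> bool" where
  "column_residue lam b \<pi> \<pi>' \<longleftrightarrow>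
     is_rpp lam \<pi> \<and> (\<forall>x y. y < b \<longrightarrow> \<pi> (x, y) = 0) \<and>
     is_filling lam \<pi>' \<and> (\<forall>x y. y \<le> b \<longrightarrow> \<pi>' (x, y) = 0) \<and>
     (\<forall>x y. (x, y) \<in> diagram lam \<and> b < y \<longrightarrow>
       \<pi>' (x, y) + \<pi> (x, y - 1) =
       (if (x + 1, y) \<in> diagram lam then min (\<pi> (x, y)) (\<pi>' (x + 1, y)) else \<pi> (x, y)) +
       max (\<pi>' (x, y - 1)) (\<pi> (x - 1, y - 1)))"

text \<open>The number of paths starting in column \<open>b\<close> that leave the diagram in row \<open>x\<close>.\<close>

definition column_exits ::
  "nat list \<Rightarrow> nat \<Rightarrow> (nat \<times> nat \<Rightarrow> nat) \<Rightarrow> (nat \<times> nat \<Rightarrow> nat) \<Rightarrow> nat \<times> nat \<Rightarrow> nat" where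
  "column_exits lam b \<pi> \<pi>' = (\<lambda>(x, y).
     if y = b \<and> (x, b) \<in> diagram lam
     then let z = lam ! (x - 1) in \<pi> (x, z) - max (\<pi>' (x, z)) (\<pi> (x - 1, z)) else 0)"

lemma diagram_row_end:
  assumes "(x, y) \<in> diagram lam"
  shows "(x, lam ! (x - 1)) \<in> diagram lam" "(x, lam ! (x - 1) + 1) \<notin> diagram lam"
    "y \<le> lam ! (x - 1)"
  using assms by (auto simp: diagram_def)

section \<open>Inequalities between a filling and its residue\<close>

locale clearing_column =
  fixes lam :: "nat list" and b :: nat and \<pi> \<pi>' :: "nat \<times> nat \<Rightarrow> nat"
  assumes part: "is_partition lam" and residue: "column_residue lam b \<pi> \<pi>'"
begin

lemma rpp: "is_rpp lam \<pi>"
  and zero_left: "y < b \<Longrightarrow> \<pi> (x, y) = 0"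
  and residue_zero_left: "y \<le> b \<Longrightarrow> \<pi>' (x, y) = 0"
  and residue_outside: "c \<notin> diagram lam \<Longrightarrow> \<pi>' c = 0"
  using residue unfolding column_residue_def is_filling_def by blast+

lemma recurrence:
  assumes "(x, y) \<in> diagram lam" "b < y"
  shows "\<pi>' (x, y) + \<pi> (x, y - 1) =
    (if (x + 1, y) \<in> diagram lam then min (\<pi> (x, y)) (\<pi>' (x + 1, y)) else \<pi> (x, y)) +
    max (\<pi>' (x, y - 1)) (\<pi> (x - 1, y - 1))"
  using residue assms unfolding column_residue_def by blast

lemma diagram_left:
  assumes "(x, y) \<in> diagram lam" "b < y" "1 \<le> b"
  shows "(x, y - 1) \<in> diagram lam"
  using diagram_down_closed[OF part assms(1), of x "y - 1"] diagram_pos[OF assms(1)] assms by simp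

lemma above_le: "(x, y) \<in> diagram lam \<Longrightarrow> \<pi> (x - 1, y) \<le> \<pi> (x, y)"
  by (rule is_rpp_above[OF rpp])

lemma below_ge: "(x + 1, y) \<in> diagram lam \<Longrightarrow> \<pi> (x, y) \<le> \<pi> (x + 1, y)"
  using above_le[of "x + 1" y] by simp

lemma left_le: "(x, y) \<in> diagram lam \<Longrightarrow> \<pi> (x, y - 1) \<le> \<pi> (x, y)"
  by (rule is_rpp_left[OF rpp])

lemma left_above_le:
  assumes "(x, y) \<in> diagram lam"
  shows "\<pi> (x - 1, y - 1) \<le> \<pi> (x, y - 1)"
proof (cases "(x, y - 1) \<in> diagram lam")
  case False
  then have "y - 1 = 0"
    using diagram_down_closed[OF part assms, of x "y - 1"] diagram_pos[OF assms] by linarith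
  then show ?thesis
    using is_rpp_outside[OF rpp] diagram_pos by (metis le_0_eq not_one_le_zero)
qed (rule above_le)

text \<open>In the recurrence the first term on the right is at most \<open>\<pi> (x, y)\<close>,
  and the maximum is at most \<open>\<pi> (x, y - 1)\<close> by induction on the column.\<close>

lemma residue_le: "\<pi>' (x, y) \<le> \<pi> (x, y)"
proof (induction y)
  case (Suc y)
  show ?case
  proof (cases "(x, Suc y) \<in> diagram lam \<and> b < Suc y")
    case True
    then show ?thesis
      using recurrence[of x "Suc y"] left_above_le[of x "Suc y"] Suc by (auto split: if_splits)
  next
    case False
    then show ?thesis using residue_outside residue_zero_left by (metis not_le zero_le)
  qed
qed (simp add: residue_zero_left)

text \<open>Going up the column, the inequality one row below shows that the first term on the right
  of the recurrence is at least \<open>\<pi> (x, y - 1)\<close>. Hence \<open>\<pi>' (x, y)\<close>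
  is at least the maximum.\<close>

lemma interlacing:
  assumes "(x, y) \<in> diagram lam" "b < y"
  shows "\<pi> (x - 1, y - 1) \<le> \<pi>' (x, y)"
  using assms
proof (induction "length lam - x" arbitrary: x rule: less_induct)
  case less
  have "\<pi> (x, y - 1) \<le> (if (x + 1, y) \<in> diagram lam then min (\<pi> (x, y)) (\<pi>' (x + 1, y)) else \<pi> (x, y))"
  proof (cases "(x + 1, y) \<in> diagram lam")
    case True
    then have "length lam - (x + 1) < length lam - x" by (auto simp: diagram_def)
    from less(1)[OF this True less(3)] show ?thesis using left_le[OF less(2)] by simp
  qed (use left_le less in simp)
  then show ?case using recurrence[OF less(2,3)] by linarith
qed

text \<open>No path is left to remove. Proceeding rightwards over the columns and upwards in each,
  the minimum collapses to \<open>\<pi> (x, y)\<close> and the maximum to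
  \<open>\<pi> (x, y - 1)\<close>.\<close>

lemma residue_eq_if_column_zero:
  assumes "\<And>x. \<pi> (x, b) = 0"
  shows "\<pi>' = \<pi>"
proof -
  have "\<pi>' (x, y) = \<pi> (x, y)" for x y
  proof (induction y arbitrary: x)
    case 0
    then show ?case using zero_left residue_zero_left assms by (metis le0 neq0_conv)
  next
    case (Suc y)
    show ?case
    proof (induction "length lam - x" arbitrary: x rule: less_induct)
      case less
      show ?case
      proof (cases "(x, Suc y) \<in> diagram lam \<and> b < Suc y")
        case True
        have "\<pi> (x, Suc y) \<le> \<pi>' (x + 1, Suc y)" if d: "(x + 1, Suc y) \<in> diagram lam"
        proof -
          have "length lam - (x + 1) < length lam - x" using d by (auto simp: diagram_def)
          from less[OF this] show ?thesis using below_ge[OF d] by simp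
        qed
        then show ?thesis
          using recurrence[of x "Suc y"] True left_above_le[of x "Suc y"] Suc
          by (auto split: if_splits)
      next
        case False
        then show ?thesis
          using residue_outside is_rpp_outside[OF rpp] zero_left residue_zero_left assms
          by (metis linorder_neqE_nat less_imp_le order_refl)
      qed
    qed
  qed
  then show ?thesis by auto
qed

end

section \<open>Removing one path\<close>

locale hg_path_step = clearing_column +
  fixes a :: nat
  assumes start: "(a, b) \<in> diagram lam" "(a + 1, b) \<notin> diagram lam" "\<pi> (a, b) \<noteq> 0"
begin

definition P where "P = set (hg_path lam \<pi> a b)"

definition \<pi>1 :: "nat \<times> nat \<Rightarrow> nat" where "\<pi>1 c = (if c \<in> P then \<pi> c - 1 else \<pi> c)"

lemma P_diagram: "c \<in> P \<Longrightarrow> c \<in> diagram lam"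
  using hg_path_subset_diagram[OF start(1)] by (auto simp: P_def)

lemma P_bound: "(x, y) \<in> P \<Longrightarrow> x \<le> a \<and> b \<le> y"
  using hg_path_bound by (auto simp: P_def)

lemma P_chain: "(u, v) \<in> P \<Longrightarrow> (u', v') \<in> P \<Longrightarrow> v < v' \<Longrightarrow> u' \<le> u"
  using hg_path_chain by (auto simp: P_def)

lemma P_pred:
  assumes "(u, v) \<in> P"
  obtains (first) "u = a" "v = b"
  | (below) "(u + 1, v) \<in> P" "\<pi> (u, v) = \<pi> (u + 1, v)" "hg_up lam \<pi> (u + 1) v"
  | (left) "1 \<le> v" "(u, v - 1) \<in> P" "\<not> hg_up lam \<pi> u (v - 1)"
  using hg_path_pred[of u v lam \<pi> a b] assms by (auto simp: P_def hg_up_def)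

lemma start_col_pos: "1 \<le> b"
  using diagram_pos[OF start(1)] by simp

text \<open>Strictness holds at the start, where \<open>\<pi>'\<close> vanishes, and travels along
  the path. Before an upward move, \<open>\<pi>' (x, y)\<close> is the minimum in the recurrence of
  the next cell and bounds its residue; before a right move the maximum is below
  \<open>\<pi> (x, y)\<close>. In particular the subtraction in \<open>\<pi>1\<close> is
  exact.\<close>

lemma residue_less_on_path:
  assumes "(u, v) \<in> P"
  shows "\<pi>' (u, v) < \<pi> (u, v)"
proof -
  have "\<forall>c \<in> set (hg_path lam \<pi> x y). \<pi>' c < \<pi> c"
    if "(x, y) \<in> diagram lam" "b \<le> y" "\<pi>' (x, y) < \<pi> (x, y)" for x y
    using that
  proof (induction x y rule: hg_path_induct[of lam \<pi>])
    case (up x y)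
    then have d: "(x - 1, y) \<in> diagram lam" "\<pi> (x - 1, y) = \<pi> (x, y)" "x - 1 + 1 = x"
      by (auto simp: hg_up_def diagram_def)
    have "\<pi>' (x - 1, y) < \<pi> (x - 1, y)"
    proof (cases "b < y")
      case True
      then have "\<pi>' (x - 1, y) + \<pi> (x - 1, y - 1) =
          \<pi>' (x, y) + max (\<pi>' (x - 1, y - 1)) (\<pi> (x - 1 - 1, y - 1))"
        using recurrence[OF d(1) True] up.prems d(2) unfolding d(3) by simp
      then show ?thesis
        using up.prems(3) d(2) max.boundedI[OF residue_le[of "x - 1" "y - 1"] left_above_le[OF d(1)]]
        by linarith
    next
      case False
      then show ?thesis using residue_zero_left up.prems d by (simp add: le_less_trans)
    qed
    then show ?case using up d by auto
  next
    case (right x y)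
    have "\<pi> (x - 1, y) < \<pi> (x, y)"
    proof (cases "(x - 1, y) \<in> diagram lam")
      case True
      then show ?thesis using right above_le[of x y] by (auto simp: hg_up_def)
    next
      case False
      then show ?thesis using right.prems is_rpp_outside[OF rpp] by simp
    qed
    then have "\<pi>' (x, y + 1) < \<pi> (x, y + 1)"
      using recurrence[OF right(2)] right.prems by (auto split: if_splits)
    then show ?case using right by auto
  qed simp
  from this[OF start(1)] show ?thesis using assms start residue_zero_left by (auto simp: P_def)
qed

lemma P_right:
  "(x, y) \<in> P \<Longrightarrow> \<not> hg_up lam \<pi> x y \<Longrightarrow> (x, y + 1) \<in> diagram lam \<Longrightarrow> (x, y + 1) \<in> P"
  using hg_path_right by (auto simp: P_def)

lemma P_up: "(x, y) \<in> P \<Longrightarrow> hg_up lam \<pi> x y \<Longrightarrow> (x - 1, y) \<in> P \<and> \<pi> (x - 1, y) = \<pi> (x, y)"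
  using hg_path_up by (auto simp: P_def hg_up_def)

text \<open>A path through the cell above would have entered it by an upward move from
  \<open>(x, y)\<close>, or from the left, which \<open>P_chain\<close> forbids. The second claim
  covers the upper boundary too: there the value above is 0.\<close>

lemma P_not_up:
  assumes "(x, y) \<in> P" "\<not> hg_up lam \<pi> x y"
  shows "(x - 1, y) \<notin> P" "\<pi> (x - 1, y) < \<pi> (x, y)"
proof -
  have x: "1 \<le> x" using diagram_pos[OF P_diagram[OF assms(1)]] by simp
  show "(x - 1, y) \<notin> P"
  proof
    assume "(x - 1, y) \<in> P"
    then show False
    proof (cases rule: P_pred)
      case first
      then show ?thesis using P_bound[OF assms(1)] x by simp
    next
      case below
      then show ?thesis using assms x by simp
    next
      case left
      then show ?thesis using P_chain[OF left(2) assms(1)] x by simp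
    qed
  qed
  show "\<pi> (x - 1, y) < \<pi> (x, y)"
  proof (cases "(x - 1, y) \<in> diagram lam")
    case True
    then show ?thesis
      using assms(2) above_le[OF P_diagram[OF assms(1)]] by (auto simp: hg_up_def)
  next
    case False
    then show ?thesis
      using residue_less_on_path[OF assms(1)] is_rpp_outside[OF rpp] by simp
  qed
qed

text \<open>No later path of the same column passes below the current one.\<close>

lemma residue_eq_below_path:
  assumes "(z, y) \<in> P" "z < x" "(x, y) \<notin> P"
  shows "\<pi>' (x, y) = \<pi> (x, y)"
  using assms
proof (induction y arbitrary: x z)
  case 0
  then show ?case using P_bound start_col_pos by force
next
  case (Suc y)
  show ?case
    using Suc.prems
  proof (induction "length lam - x" arbitrary: x z rule: less_induct)
    case less
    \<comment> \<open>The lowest path cell above row \<open>x\<close> in this column. The path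
      neither enters it from below nor starts there, so it comes from \<open>(u, y)\<close> and the
      hypothesis for column \<open>y\<close> applies.\<close>
    define u where "u = Max {u. u < x \<and> (u, Suc y) \<in> P}"
    have "finite {u. u < x \<and> (u, Suc y) \<in> P}" "z \<in> {u. u < x \<and> (u, Suc y) \<in> P}"
      using less.prems by auto
    then have "u \<in> {u. u < x \<and> (u, Suc y) \<in> P}" "\<And>v. v < x \<Longrightarrow> (v, Suc y) \<in> P \<Longrightarrow> v \<le> u"
      unfolding u_def using Max_in Max_ge by blast+
    then have u: "u < x" "(u, Suc y) \<in> P" "(u + 1, Suc y) \<notin> P"
      using less.prems(3) by (auto, metis Suc_lessI not_less_eq_eq order_refl)
    show ?case
    proof (cases "(x, Suc y) \<in> diagram lam")
      case False
      then show ?thesis using residue_outside is_rpp_outside[OF rpp] by simp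
    next
      case True
      from u(2) show ?thesis
      proof (cases rule: P_pred)
        case first
        then have "(a + 1, b) \<in> diagram lam"
          using diagram_down_closed[OF part True, of "a + 1" b] u(1) start_col_pos by simp
        then show ?thesis using start(2) by simp
      next
        case below
        then show ?thesis using u by simp
      next
        case left
        then have uy: "(u, y) \<in> P" by simp
        then have b: "b < Suc y" using P_bound by force
        have m: "\<pi> (x, Suc y) \<le> \<pi>' (x + 1, Suc y)" if d: "(x + 1, Suc y) \<in> diagram lam"
        proof -
          have "(x + 1, Suc y) \<notin> P" using P_chain[OF uy] u(1) by force
          moreover have "length lam - (x + 1) < length lam - x" using d by (auto simp: diagram_def)
          ultimately have "\<pi>' (x + 1, Suc y) = \<pi> (x + 1, Suc y)"
            using less.hyps u by (metis less_SucI Suc_eq_plus1)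
          then show ?thesis using below_ge[OF d] by simp
        qed
        \<comment> \<open>If \<open>(x, y)\<close> is on the path, the path must go up from it, as
          it misses \<open>(x, Suc y)\<close>, and the second argument attains the value. Otherwise
          the first does, by induction.\<close>
        have "max (\<pi>' (x, y)) (\<pi> (x - 1, y)) = \<pi> (x, y)"
        proof (cases "(x, y) \<in> P")
          case True
          then have "hg_up lam \<pi> x y"
            using P_right[of x y] \<open>(x, Suc y) \<in> diagram lam\<close> less.prems(3) by auto
          then show ?thesis using P_up[OF True] residue_le[of x y] by simp
        next
          case False
          then show ?thesis using Suc.IH[OF uy u(1)] left_above_le[OF True] by simp
        qed
        then show ?thesis using recurrence[OF True b] m by (auto split: if_splits)
      qed
    qed
  qed
qed

text \<open>The number of remaining paths leaving \<open>(x, y)\<close> other than upwards drops by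
  one exactly when the removed path does so. On an upward move \<open>\<pi> (x, y)\<close> and the
  maximum drop together. If only the cell above is on the path,
  \<open>\<pi>' (x, y) = \<pi> (x, y)\<close> keeps the maximum fixed.\<close>

lemma exits_step:
  assumes "(x, y) \<in> diagram lam"
  shows "\<pi>1 (x, y) + max (\<pi>' (x, y)) (\<pi> (x - 1, y)) + (if (x, y) \<in> P \<and> \<not> hg_up lam \<pi> x y then 1 else 0)
    = \<pi> (x, y) + max (\<pi>' (x, y)) (\<pi>1 (x - 1, y))"
proof (cases "(x, y) \<in> P")
  case True
  then show ?thesis
    using P_up[OF True] P_not_up[OF True] residue_less_on_path[OF True]
    by (cases "hg_up lam \<pi> x y") (auto simp: \<pi>1_def)
next
  case False
  have "\<pi>' (x, y) = \<pi> (x, y)" if "(x - 1, y) \<in> P"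
    using residue_eq_below_path[OF that _ False] diagram_pos[OF assms] by simp
  then show ?thesis using False above_le[OF assms] by (auto simp: \<pi>1_def)
qed

text \<open>A path entering from the left has nothing below it in this column, so the minimum is
  \<open>\<pi> (x, y)\<close> and drops. A path entering from below makes
  \<open>\<pi>' (x + 1, y)\<close> the minimum, which stays.\<close>

lemma entries_from_below_step:
  assumes "(x, y) \<in> diagram lam" "b < y"
  shows "(if (x + 1, y) \<in> diagram lam then min (\<pi>1 (x, y)) (\<pi>' (x + 1, y)) else \<pi>1 (x, y)) +
      (if (x, y - 1) \<in> P \<and> \<not> hg_up lam \<pi> x (y - 1) then 1 else 0) =
    (if (x + 1, y) \<in> diagram lam then min (\<pi> (x, y)) (\<pi>' (x + 1, y)) else \<pi> (x, y))"
proof (cases "(x, y - 1) \<in> P \<and> \<not> hg_up lam \<pi> x (y - 1)")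
  case True
  then have xy: "(x, y) \<in> P" using P_right[of x "y - 1"] assms by simp
  have "(x + 1, y) \<notin> P" using P_chain[of x "y - 1" "x + 1" y] True assms(2) by auto
  then have "\<pi>' (x + 1, y) = \<pi> (x + 1, y)" using residue_eq_below_path[OF xy] by simp
  then show ?thesis
    using True xy below_ge[of x y] residue_less_on_path[OF xy] by (auto simp: \<pi>1_def)
next
  case False
  show ?thesis
  proof (cases "(x, y) \<in> P")
    case True
    then show ?thesis
    proof (cases rule: P_pred)
      case first
      then show ?thesis using assms by simp
    next
      case below
      then show ?thesis
        using False True P_diagram[OF below(1)] residue_less_on_path[OF below(1)]
        by (auto simp: \<pi>1_def)
    next
      case left
      then show ?thesis using False by simp
    qed
  next
    case xy: False
    then show ?thesis using False by (auto simp: \<pi>1_def)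
  qed
qed

text \<open>Monotonicity could fail only where a path cell follows a cell off the path, and there
  the inequality is strict. When the path enters \<open>(x, y + 1)\<close> from below, this is
  \<open>interlacing\<close> in row \<open>x + 1\<close> followed by
  \<open>residue_less_on_path\<close>.\<close>

lemma rpp_step: "is_rpp lam \<pi>1"
proof (rule is_rppI_adjacent[OF part])
  show "is_filling lam \<pi>1"
    using is_rpp_outside[OF rpp] by (auto simp: is_filling_def \<pi>1_def)
next
  fix x y assume d: "(x, y) \<in> diagram lam" "(x, y + 1) \<in> diagram lam"
  have le: "\<pi> (x, y) \<le> \<pi> (x, y + 1)" using left_le[OF d(2)] by simp
  have "\<pi> (x, y) < \<pi> (x, y + 1)" if P: "(x, y + 1) \<in> P" "(x, y) \<notin> P"
  proof (cases "y < b")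
    case True
    then show ?thesis using zero_left residue_less_on_path[OF P(1)] by simp
  next
    case False
    from P(1) show ?thesis
    proof (cases rule: P_pred)
      case first
      then show ?thesis using False by simp
    next
      case below
      then show ?thesis
        using interlacing[OF P_diagram[OF below(1)]] residue_less_on_path[OF below(1)] False by simp
    next
      case left
      then show ?thesis using P by simp
    qed
  qed
  then show "\<pi>1 (x, y) \<le> \<pi>1 (x, y + 1)" using le by (auto simp: \<pi>1_def)
next
  fix x y assume d: "(x, y) \<in> diagram lam" "(x + 1, y) \<in> diagram lam"
  have "\<pi> (x, y) < \<pi> (x + 1, y)" if P: "(x + 1, y) \<in> P" "(x, y) \<notin> P"
    using P_up[OF P(1)] P_not_up(2)[OF P(1)] P(2) by auto
  then show "\<pi>1 (x, y) \<le> \<pi>1 (x + 1, y)" using below_ge[OF d(2)] by (auto simp: \<pi>1_def)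
qed

text \<open>The path leaves \<open>(x, y - 1)\<close> other than upwards exactly when it enters
  \<open>(x, y)\<close> from the left. The drops in \<open>exits_step\<close> and
  \<open>entries_from_below_step\<close> therefore cancel, and the same \<open>\<pi>'\<close> still
  solves the recurrence.\<close>

lemma residue_step: "column_residue lam b \<pi>1 \<pi>'"
  unfolding column_residue_def
proof (intro conjI allI impI rpp_step)
  show "is_filling lam \<pi>'" using residue_outside by (simp add: is_filling_def)
next
  fix x y assume "(x, y) \<in> diagram lam \<and> b < y"
  then have d: "(x, y) \<in> diagram lam" "b < y" by auto
  show "\<pi>' (x, y) + \<pi>1 (x, y - 1) =
    (if (x + 1, y) \<in> diagram lam then min (\<pi>1 (x, y)) (\<pi>' (x + 1, y)) else \<pi>1 (x, y)) +
    max (\<pi>' (x, y - 1)) (\<pi>1 (x - 1, y - 1))"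
    using recurrence[OF d] entries_from_below_step[OF d]
      exits_step[OF diagram_left[OF d start_col_pos]] by linarith
qed (auto simp: \<pi>1_def zero_left residue_zero_left)

lemma column_exits_step:
  defines "r \<equiv> fst (last (hg_path lam \<pi> a b))"
  shows "column_exits lam b \<pi> \<pi>' = (column_exits lam b \<pi>1 \<pi>')((r, b) := column_exits lam b \<pi>1 \<pi>' (r, b) + 1)"
proof -
  have last: "last (hg_path lam \<pi> a b) = (r, snd (last (hg_path lam \<pi> a b)))"
    by (simp add: r_def)
  define s where "s = snd (last (hg_path lam \<pi> a b))"
  have rs: "(r, s) \<in> P" "\<not> hg_up lam \<pi> r s" "(r, s + 1) \<notin> diagram lam"
    using hg_path_last_iff[of r s lam \<pi> a b] last by (auto simp: s_def P_def)
  have rd: "(r, s) \<in> diagram lam" using P_diagram rs by simp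
  have s: "s = lam ! (r - 1)"
    using rs(3) rd by (auto simp: diagram_def)
  have rb: "(r, b) \<in> diagram lam"
    using diagram_down_closed[OF part rd, of r b] diagram_pos[OF rd] start_col_pos P_bound[OF rs(1)]
    by simp
  have "column_exits lam b \<pi> \<pi>' (x, b) = column_exits lam b \<pi>1 \<pi>' (x, b) + (if x = r then 1 else 0)"
    if x: "(x, b) \<in> diagram lam" for x
  proof -
    define z where "z = lam ! (x - 1)"
    have z: "(x, z) \<in> diagram lam" "(x, z + 1) \<notin> diagram lam"
      using diagram_row_end[OF x] by (auto simp: z_def)
    \<comment> \<open>At the end of a row, not going up means stopping, so the drop in
      \<open>exits_step\<close> marks the exit row.\<close>
    have iff: "(x, z) \<in> P \<and> \<not> hg_up lam \<pi> x z \<longleftrightarrow> x = r"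
      using hg_path_last_iff[of x z lam \<pi> a b] z last rs s by (auto simp: P_def z_def s_def)
    \<comment> \<open>Supplies the bounds that make the truncated subtraction in
      \<open>column_exits\<close> exact for \<open>\<pi>1\<close> as well.\<close>
    interpret S: clearing_column lam b \<pi>1 \<pi>'
      using part residue_step by unfold_locales
    have exits: "column_exits lam b \<rho> \<pi>' (x, b) = \<rho> (x, z) - max (\<pi>' (x, z)) (\<rho> (x - 1, z))" for \<rho>
      using x by (simp add: column_exits_def z_def Let_def)
    have "p - m = p1 - m1 + e" if "p1 + m + e = p + m1" "m \<le> p" "m1 \<le> p1" for p m p1 m1 e :: nat
      using that by linarith
    from this[OF exits_step[OF z(1)] max.boundedI[OF residue_le above_le[OF z(1)]]
        max.boundedI[OF S.residue_le S.above_le[OF z(1)]]]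
    show ?thesis unfolding iff exits .
  qed
  then show ?thesis
    using rb by (auto simp: fun_eq_iff column_exits_def)
qed

end

lemma clearing_columnI:
  "is_partition lam \<Longrightarrow> column_residue lam b \<pi> \<pi>' \<Longrightarrow> clearing_column lam b \<pi> \<pi>'"
  by unfold_locales

section \<open>Existence of the residue\<close>

function column_toggle :: "nat list \<Rightarrow> nat \<Rightarrow> (nat \<times> nat \<Rightarrow> nat) \<Rightarrow> nat \<Rightarrow> nat \<Rightarrow> nat" where
  "column_toggle lam b \<pi> x y =
    (if (x, y) \<in> diagram lam \<and> b < y then
      (if (x + 1, y) \<in> diagram lam then min (\<pi> (x, y)) (column_toggle lam b \<pi> (x + 1) y)
       else \<pi> (x, y)) +
      max (column_toggle lam b \<pi> x (y - 1)) (\<pi> (x - 1, y - 1)) - \<pi> (x, y - 1)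
     else 0)"
  by pat_completeness auto
termination
  by (relation "measures [\<lambda>(lam, b, \<pi>, x, y). y, \<lambda>(lam, b, \<pi>, x, y). length lam - x]")
    (auto simp: diagram_def)

declare column_toggle.simps [simp del]

text \<open>\<open>column_toggle\<close> solves the recurrence for its leftmost term, using the
  cells below and to the left. The argument of \<open>interlacing\<close>, repeated as
  \<open>key\<close>, shows that its truncated subtraction is exact.\<close>

lemma column_residue_exists:
  assumes part: "is_partition lam" and rpp: "is_rpp lam \<pi>"
    and zero: "\<And>x y. y < b \<Longrightarrow> \<pi> (x, y) = 0"
  shows "\<exists>\<pi>'. column_residue lam b \<pi> \<pi>'"
proof -
  define t where "t = column_toggle lam b \<pi>"
  note t_simps = column_toggle.simps[of lam b \<pi>, folded t_def]
  have key: "\<pi> (x, y - 1) \<le> (if (x + 1, y) \<in> diagram lam then min (\<pi> (x, y)) (t (x + 1) y) else \<pi> (x, y))"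
    if "(x, y) \<in> diagram lam" "b < y" for x y
    using that
  proof (induction "length lam - x" arbitrary: x rule: less_induct)
    case less
    have left: "\<pi> (x, y - 1) \<le> \<pi> (x, y)"
      using is_rpp_left[OF rpp less(2)] .
    show ?case
    proof (cases "(x + 1, y) \<in> diagram lam")
      case True
      then have "length lam - (x + 1) < length lam - x" by (auto simp: diagram_def)
      from less(1)[OF this True less(3)] have "\<pi> (x, y - 1) \<le> t (x + 1) y"
        using True less(3) by (subst t_simps) simp
      then show ?thesis using left by simp
    qed (use left in simp)
  qed
  have "column_residue lam b \<pi> (\<lambda>(x, y). t x y)"
    unfolding column_residue_def
  proof (intro conjI allI impI)
    show "is_filling lam (\<lambda>(x, y). t x y)"
      by (auto simp: is_filling_def t_simps)
  next
    fix x y assume "(x, y) \<in> diagram lam \<and> b < y"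
    then have d: "(x, y) \<in> diagram lam" "b < y" by auto
    have t: "t x y = (if (x + 1, y) \<in> diagram lam then min (\<pi> (x, y)) (t (x + 1) y) else \<pi> (x, y)) +
      max (t x (y - 1)) (\<pi> (x - 1, y - 1)) - \<pi> (x, y - 1)"
      using d by (subst t_simps) simp
    show "(case (x, y) of (x, y) \<Rightarrow> t x y) + \<pi> (x, y - 1) =
      (if (x + 1, y) \<in> diagram lam then min (\<pi> (x, y)) (case (x + 1, y) of (x, y) \<Rightarrow> t x y)
       else \<pi> (x, y)) +
      max (case (x, y - 1) of (x, y) \<Rightarrow> t x y) (\<pi> (x - 1, y - 1))"
      unfolding prod.case t by (rule le_add_diff_inverse2[OF trans_le_add1[OF key[OF d]]])
  qed (use rpp zero in \<open>auto simp: t_simps\<close>)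
  then show ?thesis by blast
qed

section \<open>The algorithm column by column\<close>

text \<open>Starting from an arbitrary array lets an induction carry the counts already
  recorded.\<close>

definition hg_run ::
  "nat list \<Rightarrow> (nat \<times> nat \<Rightarrow> nat) \<Rightarrow> (nat \<times> nat \<Rightarrow> nat) \<Rightarrow> nat \<times> nat \<Rightarrow> nat" where
  "hg_run lam \<pi> A = snd (while (\<lambda>(\<pi>, A). \<exists>c \<in> diagram lam. \<pi> c \<noteq> 0) (hg_step lam) (\<pi>, A))"

lemma HG_eq_hg_run: "HG lam \<pi> = hg_run lam \<pi> (\<lambda>_. 0)"
  by (simp add: HG_def hg_run_def)

lemma hg_run_zero:
  assumes "\<forall>c \<in> diagram lam. \<pi> c = 0"
  shows "hg_run lam \<pi> A = A"
  unfolding hg_run_def by (subst while_unfold) (use assms in auto)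

lemma hg_run_step:
  assumes "\<exists>c \<in> diagram lam. \<pi> c \<noteq> 0" "hg_step lam (\<pi>, A) = (\<pi>1, A1)"
  shows "hg_run lam \<pi> A = hg_run lam \<pi>1 A1"
  unfolding hg_run_def by (subst while_unfold) (use assms in auto)

lemma hg_start_col_eq:
  assumes "(x, b) \<in> diagram lam" "\<pi> (x, b) \<noteq> 0" "\<And>x y. y < b \<Longrightarrow> \<pi> (x, y) = 0"
  shows "hg_start_col lam \<pi> = b"
  unfolding hg_start_col_def using assms by (intro Least_equality) (auto simp: not_less[symmetric])

lemma hg_start_row_bottom:
  assumes "is_rpp lam \<pi>" "\<exists>c \<in> diagram lam. \<pi> c \<noteq> 0"
  shows "(hg_start_row lam \<pi> + 1, hg_start_col lam \<pi>) \<notin> diagram lam"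
proof
  let ?a = "hg_start_row lam \<pi>" and ?b = "hg_start_col lam \<pi>"
  assume d: "(?a + 1, ?b) \<in> diagram lam"
  have "\<pi> (?a, ?b) \<le> \<pi> (?a + 1, ?b)"
    using is_rpp_column[OF assms(1) hg_start_cell(1)[OF assms(2)] d] by simp
  then have "(?a + 1, ?b) \<in> diagram lam \<and> \<pi> (?a + 1, ?b) \<noteq> 0"
    using hg_start_cell(2)[OF assms(2)] d by simp
  then have "?a + 1 \<le> ?a"
    unfolding hg_start_row_def[of lam \<pi>]
    by (rule Greatest_le_nat[where b = "length lam"]) (auto simp: diagram_def)
  then show False by simp
qed

text \<open>Paths are removed one at a time while \<open>\<pi>'\<close> stays fixed and the sum of
  the entries decreases. Once column \<open>b\<close> is zero the current filling equals
  \<open>\<pi>'\<close>, which is also how \<open>\<pi>'\<close> is seen to be a reverse plane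
  partition.\<close>

lemma hg_run_column:
  assumes "is_partition lam" "column_residue lam b \<pi> \<pi>'"
  shows "is_rpp lam \<pi>'" "hg_run lam \<pi> A = hg_run lam \<pi>' (\<lambda>c. A c + column_exits lam b \<pi> \<pi>' c)"
proof -
  have "is_rpp lam \<pi>' \<and> hg_run lam \<pi> A = hg_run lam \<pi>' (\<lambda>c. A c + column_exits lam b \<pi> \<pi>' c)"
    using assms
  proof (induction "sum \<pi> (diagram lam)" arbitrary: \<pi> A rule: less_induct)
    case less
    interpret clearing_column lam b \<pi> \<pi>' using less.prems by (rule clearing_columnI)
    show ?case
    proof (cases "\<exists>x. \<pi> (x, b) \<noteq> 0")
      case False
      then have "\<pi>' = \<pi>" using residue_eq_if_column_zero by blast
      moreover from this have "column_exits lam b \<pi> \<pi>' c = 0" for c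
        using diagram_row_end(1) above_le by (cases c) (auto simp: column_exits_def Let_def)
      ultimately show ?thesis using rpp by simp
    next
      case True
      then obtain x where x: "\<pi> (x, b) \<noteq> 0" by blast
      then have xd: "(x, b) \<in> diagram lam" using is_rpp_outside[OF rpp, of "(x, b)"] by auto
      have ex: "\<exists>c \<in> diagram lam. \<pi> c \<noteq> 0" using x xd by blast
      have b: "hg_start_col lam \<pi> = b" using hg_start_col_eq[of x b lam \<pi>, OF xd x zero_left] .
      define a where "a = hg_start_row lam \<pi>"
      interpret hg_path_step lam b \<pi> \<pi>' a
        using hg_start_cell[OF ex] hg_start_row_bottom[OF rpp ex] by unfold_locales (auto simp: a_def b)
      define r where "r = fst (last (hg_path lam \<pi> a b))"
      have step: "hg_step lam (\<pi>, A) = (\<pi>1, A((r, b) := A (r, b) + 1))"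
        by (auto simp: hg_step_def b Let_def a_def[symmetric] r_def \<pi>1_def P_def fun_eq_iff)
      have "sum \<pi>1 (diagram lam) < sum \<pi> (diagram lam)"
      proof (rule sum_strict_mono_ex1[OF finite_diagram])
        show "\<exists>c\<in>diagram lam. \<pi>1 c < \<pi> c"
          using start by (intro bexI[of _ "(a, b)"]) (auto simp: \<pi>1_def P_def hg_path_start)
      qed (simp add: \<pi>1_def)
      note IH = less.hyps[OF this part residue_step]
      then have "hg_run lam \<pi> A =
        hg_run lam \<pi>' (\<lambda>c. (A((r, b) := A (r, b) + 1)) c + column_exits lam b \<pi>1 \<pi>' c)"
        using hg_run_step[OF ex step] by simp
      also have "(\<lambda>c. (A((r, b) := A (r, b) + 1)) c + column_exits lam b \<pi>1 \<pi>' c) =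
        (\<lambda>c. A c + column_exits lam b \<pi> \<pi>' c)"
        unfolding column_exits_step r_def[symmetric] by auto
      finally show ?thesis using IH by blast
    qed
  qed
  then show "is_rpp lam \<pi>'" "hg_run lam \<pi> A = hg_run lam \<pi>' (\<lambda>c. A c + column_exits lam b \<pi> \<pi>' c)"
    by blast+
qed

section \<open>Adding a filling that is constant along rows\<close>

definition row_filling :: "nat list \<Rightarrow> nat \<Rightarrow> (nat \<Rightarrow> nat) \<Rightarrow> nat \<times> nat \<Rightarrow> nat" where
  "row_filling lam b S = (\<lambda>(x, y). if (x, y) \<in> diagram lam \<and> b \<le> y then S x else 0)"

text \<open>The hypothesis \<open>S 0 = 0\<close> matches the value 0 outside the diagram, so row 1
  needs no exception in the recurrence.\<close>

lemma row_filling_above: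
  assumes "is_partition lam" "S 0 = 0" "(x, y) \<in> diagram lam" "b \<le> y"
  shows "row_filling lam b S (x - 1, y) = S (x - 1)"
proof (cases "1 \<le> x - 1")
  case True
  then have "(x - 1, y) \<in> diagram lam"
    using diagram_down_closed[OF assms(1,3), of "x - 1" y] diagram_pos[OF assms(3)] by simp
  then show ?thesis using assms(4) by (simp add: row_filling_def)
next
  case False
  then have "x - 1 = 0" by linarith
  then show ?thesis using assms(2) by (simp add: row_filling_def)
qed

lemma is_rpp_add_row_filling:
  assumes part: "is_partition lam" and rpp: "is_rpp lam T" and S: "mono S"
  shows "is_rpp lam (\<lambda>c. T c + row_filling lam b S c)"
proof (rule is_rppI_adjacent[OF part])
  show "is_filling lam (\<lambda>c. T c + row_filling lam b S c)"
    using is_rpp_outside[OF rpp] by (auto simp: is_filling_def row_filling_def)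
next
  fix x y assume "(x, y) \<in> diagram lam" "(x, y + 1) \<in> diagram lam"
  then show "T (x, y) + row_filling lam b S (x, y) \<le> T (x, y + 1) + row_filling lam b S (x, y + 1)"
    using is_rpp_row[OF rpp, of x y "y + 1"] by (auto simp: row_filling_def)
next
  fix x y assume "(x, y) \<in> diagram lam" "(x + 1, y) \<in> diagram lam"
  then show "T (x, y) + row_filling lam b S (x, y) \<le> T (x + 1, y) + row_filling lam b S (x + 1, y)"
    using is_rpp_column[OF rpp, of x y "x + 1"] monoD[OF S, of x "x + 1"]
    by (auto simp: row_filling_def)
qed

text \<open>Clearing a column shifts the added rows down by one.\<close>

lemma column_residue_add_row_filling:
  assumes part: "is_partition lam" and res: "column_residue lam b T T'" and b: "1 \<le> b"
    and S: "mono S" "S 0 = 0"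
  shows "column_residue lam b (\<lambda>c. T c + row_filling lam b S c)
    (\<lambda>c. T' c + row_filling lam (b + 1) (\<lambda>x. S (x - 1)) c)"
proof -
  interpret clearing_column lam b T T' using part res by (rule clearing_columnI)
  show ?thesis
    unfolding column_residue_def
  proof (intro conjI allI impI)
    show "is_rpp lam (\<lambda>c. T c + row_filling lam b S c)"
      using is_rpp_add_row_filling[OF part rpp S(1)] .
    show "is_filling lam (\<lambda>c. T' c + row_filling lam (b + 1) (\<lambda>x. S (x - 1)) c)"
      using residue_outside by (auto simp: is_filling_def row_filling_def)
  next
    fix x y assume "(x, y) \<in> diagram lam \<and> b < y"
    then have d: "(x, y) \<in> diagram lam" "b < y" by auto
    have d': "(x, y - 1) \<in> diagram lam" "b \<le> y - 1" using diagram_left[OF d b] d by auto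
    let ?R = "row_filling lam b S" and ?R' = "row_filling lam (b + 1) (\<lambda>x. S (x - 1))"
    have R: "?R (x, y) = S x" "?R (x, y - 1) = S x" "?R (x - 1, y - 1) = S (x - 1)"
      "?R' (x, y) = S (x - 1)"
      using d d' row_filling_above[of lam S x "y - 1" b] part S(2) by (auto simp: row_filling_def)
    have R'_below: "(x + 1, y) \<in> diagram lam \<Longrightarrow> ?R' (x + 1, y) = S x"
      using d by (simp add: row_filling_def)
    \<comment> \<open>Both arguments of the minimum grow by \<open>S x\<close>, since the shift in
      row \<open>x + 1\<close> of the residue is \<open>S (x + 1 - 1)\<close>.\<close>
    have entries: "(if (x + 1, y) \<in> diagram lam
       then min (T (x, y) + S x) (T' (x + 1, y) + ?R' (x + 1, y)) else T (x, y) + S x) =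
      (if (x + 1, y) \<in> diagram lam then min (T (x, y)) (T' (x + 1, y)) else T (x, y)) + S x"
      using R'_below by (simp add: min_add_distrib_left)
    have exits: "max (T' (x, y - 1) + ?R' (x, y - 1)) (T (x - 1, y - 1) + ?R (x - 1, y - 1)) =
      max (T' (x, y - 1)) (T (x - 1, y - 1)) + S (x - 1)"
    proof (cases "b < y - 1")
      case True
      then have "?R' (x, y - 1) = S (x - 1)" using d' by (simp add: row_filling_def)
      then show ?thesis unfolding R max_add_distrib_left by simp
    next
      case False
      \<comment> \<open>Here \<open>y - 1 = b\<close>: the first argument of the maximum is not
        shifted, but it is 0, so the second one decides.\<close>
      then have "?R' (x, y - 1) = 0" by (simp add: row_filling_def)
      then show ?thesis unfolding R using False residue_zero_left[of "y - 1" x] by simp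
    qed
    have shift: "p + s' + (q + s) = m + s + (k + s')" if "p + q = m + k" for p q m k s s' :: nat
      using that by linarith
    show "T' (x, y) + ?R' (x, y) + (T (x, y - 1) + ?R (x, y - 1)) =
      (if (x + 1, y) \<in> diagram lam
       then min (T (x, y) + ?R (x, y)) (T' (x + 1, y) + ?R' (x + 1, y)) else T (x, y) + ?R (x, y)) +
      max (T' (x, y - 1) + ?R' (x, y - 1)) (T (x - 1, y - 1) + ?R (x - 1, y - 1))"
      unfolding R exits[unfolded R] entries by (rule shift[OF recurrence[OF d]])
  qed (auto simp: row_filling_def zero_left residue_zero_left)
qed

text \<open>At the end of row \<open>x\<close> the entry grows by \<open>S x\<close> and the maximum
  by \<open>S (x - 1)\<close>.\<close>

lemma column_exits_add_row_filling:
  assumes part: "is_partition lam" and res: "column_residue lam b T T'" and b: "1 \<le> b"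
    and S: "mono S" "S 0 = 0" and d: "(x, b) \<in> diagram lam"
  shows "column_exits lam b (\<lambda>c. T c + row_filling lam b S c)
      (\<lambda>c. T' c + row_filling lam (b + 1) (\<lambda>x. S (x - 1)) c) (x, b) =
    column_exits lam b T T' (x, b) + (S x - S (x - 1))"
proof -
  interpret clearing_column lam b T T' using part res by (rule clearing_columnI)
  let ?R = "row_filling lam b S" and ?R' = "row_filling lam (b + 1) (\<lambda>x. S (x - 1))"
  define z where "z = lam ! (x - 1)"
  have z: "(x, z) \<in> diagram lam" "b \<le> z"
    using diagram_row_end[OF d] by (auto simp: z_def)
  have R: "?R (x, z) = S x" "?R (x - 1, z) = S (x - 1)"
    using z row_filling_above[of lam S x z b] part S(2) by (auto simp: row_filling_def)
  have mx: "max (T' (x, z) + ?R' (x, z)) (T (x - 1, z) + ?R (x - 1, z)) =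
    max (T' (x, z)) (T (x - 1, z)) + S (x - 1)"
  proof (cases "b < z")
    case True
    then have "?R' (x, z) = S (x - 1)" using z by (simp add: row_filling_def)
    then show ?thesis unfolding R max_add_distrib_left by simp
  next
    case False
    then have "?R' (x, z) = 0" by (simp add: row_filling_def)
    then show ?thesis unfolding R using False residue_zero_left[of z x] by simp
  qed
  have exits: "column_exits lam b \<rho> \<rho>' (x, b) = \<rho> (x, z) - max (\<rho>' (x, z)) (\<rho> (x - 1, z))" for \<rho> \<rho>'
    using d by (simp add: column_exits_def z_def Let_def)
  have "max (T' (x, z)) (T (x - 1, z)) \<le> T (x, z)" "S (x - 1) \<le> S x"
    using residue_le[of x z] above_le[OF z(1)] monoD[OF S(1), of "x - 1" x] by auto
  then show ?thesis unfolding exits R mx[unfolded R] by linarith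
qed

text \<open>Clearing columns \<open>b\<close> to \<open>y - 1\<close> turns \<open>S\<close> into
  \<open>\<lambda>x. S (x - (y - b))\<close>, and column \<open>y\<close> then records the
  increments of this function.\<close>

definition shifted_increments :: "nat list \<Rightarrow> nat \<Rightarrow> (nat \<Rightarrow> nat) \<Rightarrow> nat \<times> nat \<Rightarrow> nat" where
  "shifted_increments lam b S = (\<lambda>(x, y).
     if (x, y) \<in> diagram lam \<and> b \<le> y then S (x - (y - b)) - S (x - (y - b) - 1) else 0)"

lemma hg_run_add_row_filling:
  assumes "is_partition lam" "is_rpp lam T" "1 \<le> b" "\<And>x y. y < b \<Longrightarrow> T (x, y) = 0"
    and "mono S" "S 0 = 0"
  shows "hg_run lam (\<lambda>c. T c + row_filling lam b S c) (\<lambda>c. A c + B c) =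
    (\<lambda>c. hg_run lam T A c + B c + shifted_increments lam b S c)"
  using assms
\<comment> \<open>Column indices are at most \<open>sum_list lam\<close>, so at 0 no columns remain.
  The array \<open>B\<close> holds the part of the counts due to the added filling.\<close>
proof (induction "Suc (sum_list lam) - b" arbitrary: b T S A B)
  case 0
  have out: "y < b" if "(x, y) \<in> diagram lam" for x y
  proof -
    have "x - 1 < length lam" "y \<le> lam ! (x - 1)" using that by (auto simp: diagram_def)
    then have "y \<le> sum_list lam" using member_le_sum_list[of "lam ! (x - 1)" lam] by simp
    then show ?thesis using 0 by simp
  qed
  have "\<forall>c \<in> diagram lam. T c = 0" using out 0 by auto
  moreover have "row_filling lam b S = (\<lambda>_. 0)" "shifted_increments lam b S = (\<lambda>_. 0)"
    using out by (force simp: row_filling_def shifted_increments_def)+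
  ultimately show ?case by (simp add: hg_run_zero)
next
  case (Suc n)
  obtain T' where res: "column_residue lam b T T'"
    using column_residue_exists Suc.prems by blast
  let ?S' = "\<lambda>x. S (x - 1)"
  let ?T = "\<lambda>c. T c + row_filling lam b S c" and ?T' = "\<lambda>c. T' c + row_filling lam (b + 1) ?S' c"
  have res': "column_residue lam b ?T ?T'"
    using column_residue_add_row_filling[OF Suc.prems(1) res Suc.prems(3,5,6)] .
  have T': "is_rpp lam T'" "\<And>x y. y < b + 1 \<Longrightarrow> T' (x, y) = 0"
    using hg_run_column(1)[OF Suc.prems(1) res] res by (auto simp: column_residue_def)
  have S': "mono ?S'" "?S' 0 = 0"
    using Suc.prems(5,6) by (auto simp: mono_def)
  have n: "n = Suc (sum_list lam) - (b + 1)" using Suc.hyps(2) by linarith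
  define E where "E = column_exits lam b T T'"
  define I where "I = (\<lambda>(x, y). if y = b \<and> (x, b) \<in> diagram lam then S x - S (x - 1) else 0)"
  have exits: "column_exits lam b ?T ?T' c = E c + I c" for c
    using column_exits_add_row_filling[OF Suc.prems(1) res Suc.prems(3,5,6)]
    by (cases c) (auto simp: E_def I_def column_exits_def)
  have incr: "I c + shifted_increments lam (b + 1) ?S' c = shifted_increments lam b S c" for c
  proof -
    obtain x y where c: "c = (x, y)" by force
    show ?thesis
    proof (cases "b < y")
      case True
      then have shift: "x - (y - (b + 1)) - 1 = x - (y - b)" by linarith
      show ?thesis using True unfolding c I_def shifted_increments_def prod.case shift by simp
    qed (auto simp: c I_def shifted_increments_def)
  qed
  have "hg_run lam ?T (\<lambda>c. A c + B c) =
      hg_run lam ?T' (\<lambda>c. A c + B c + column_exits lam b ?T ?T' c)"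
    by (rule hg_run_column(2)[OF Suc.prems(1) res'])
  also have "(\<lambda>c. A c + B c + column_exits lam b ?T ?T' c) = (\<lambda>c. (A c + E c) + (B c + I c))"
    unfolding exits by (rule ext) simp
  also have "hg_run lam ?T' (\<lambda>c. (A c + E c) + (B c + I c)) =
      (\<lambda>c. hg_run lam T' (\<lambda>c. A c + E c) c + (B c + I c) + shifted_increments lam (b + 1) ?S' c)"
    by (rule Suc.hyps(1)[OF n Suc.prems(1) T'(1) _ T'(2) S']) simp
  also have "\<dots> = (\<lambda>c. hg_run lam T A c + B c + shifted_increments lam b S c)"
    unfolding hg_run_column(2)[OF Suc.prems(1) res, of A, folded E_def] incr[symmetric]
    by (rule ext) simp
  finally show ?case .
qed

corollary HG_add_row_filling:
  assumes "is_partition lam" "is_rpp lam T" "mono S" "S 0 = 0"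
  shows "HG lam (\<lambda>c. T c + row_filling lam 1 S c) =
    (\<lambda>c. HG lam T c + shifted_increments lam 1 S c)"
proof -
  have "T (x, y) = 0" if "y < 1" for x y
    using is_rpp_outside[OF assms(2), of "(x, y)"] diagram_pos[of x y lam] that by force
  from hg_run_add_row_filling[OF assms(1,2) _ this assms(3,4), where A = "\<lambda>_. 0" and B = "\<lambda>_. 0"]
  show ?thesis by (simp add: HG_eq_hg_run)
qed

theorem theorem1p12:
  fixes lam :: "nat list" and T :: "nat \<times> nat \<Rightarrow> nat"
  assumes "is_partition lam"
    and "is_rpp lam T"
  shows "(\<lambda>c. HG lam T c + HG lam (T_min lam) c) = HG lam (\<lambda>c. T c + T_min lam c)"
proof -
  define S where "S = (\<lambda>x::nat. x - 1)"
  have S: "mono S" "S 0 = 0" by (auto simp: S_def mono_def)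
  have T_min: "T_min lam = row_filling lam 1 S"
    by (auto simp: T_min_def row_filling_def S_def fun_eq_iff diagram_def)
  \<comment> \<open>Adding \<open>T_min\<close> to the zero filling identifies the correction array,
    which does not depend on \<open>T\<close>, as the image of \<open>T_min\<close>.\<close>
  have "is_rpp lam (\<lambda>_. 0)"
    by (simp add: is_rpp_def is_filling_def weakly_increasing_rows_def weakly_increasing_columns_def)
  from HG_add_row_filling[OF assms(1) this S]
  have "HG lam (T_min lam) = shifted_increments lam 1 S"
    by (simp add: T_min HG_eq_hg_run hg_run_zero)
  then show ?thesis
    using HG_add_row_filling[OF assms S] by (simp add: T_min)
qed

end
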